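(* Let $n\in\mathbb{N}$. There is a constant $c_n>0$ depending only on $n$ such that for all $\alpha\in[0,1]$, all $r\in\mathbb{N}$ and all $\ell\in\mathbb{N}_0$, \[ \Pi_{r,\boldsymbol c^{(\ell)}}(\alpha)\le c_n\,2^{-r}\left(\cot\frac{\pi}{2(2^n+1)}\right)^{r/n}. \] Moreover, for every $L\in\mathbb{N}$, \[ \Pi_{nL,\boldsymbol c}\left(\frac{2^{n-1}}{2^n+1}\right)=2^{-nL}\left(\cot\frac{\pi}{2(2^n+1)}\right)^L. \]
   Context: $\boldsymbol{c}=(c_0,c_1,\ldots)$ is the periodic sequence with $c_j=1$ if $n\mid j$ and $c_j=0$ otherwise, and $\boldsymbol c^{(\ell)}=(c_\ell,c_{\ell+1},\ldots)$. For $\boldsymbol\gamma\in\{0,1\}^{\mathbb{N}_0}$, $\Pi_{r,\boldsymbol\gamma}(\alpha)=\prod_{j=0}^{r-1}\left|\cos\left(2^j\alpha\pi+\frac{\gamma_j\pi}{2}\right)\right|$. *)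

theory Defs
  imports Complex_Main
begin

text \<open>
  The product \<open>\<Pi>\<^bsub>r,\<gamma>\<^esub>(\<alpha>)\<close>. The sequence \<open>\<gamma>\<close> is meant to take values in \<open>{0,1}\<close>; this is not
  enforced by the type, but it holds for \<open>c_seq n\<close> and all its shifts.
\<close>

definition cos_prod :: "nat \<Rightarrow> (nat \<Rightarrow> nat) \<Rightarrow> real \<Rightarrow> real" where
  "cos_prod r \<gamma> \<alpha> = (\<Prod>j<r. \<bar>cos (2 ^ j * \<alpha> * pi + real (\<gamma> j) * pi / 2)\<bar>)"

definition c_seq :: "nat \<Rightarrow> nat \<Rightarrow> nat" where
  "c_seq n j = (if n dvd j then 1 else 0)"

definition shift_seq :: "nat \<Rightarrow> (nat \<Rightarrow> 'a) \<Rightarrow> nat \<Rightarrow> 'a" where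
  "shift_seq l \<gamma> j = \<gamma> (l + j)"

end

theory Submission
  imports Defs "HOL-Analysis.Complex_Transcendental" "HOL-Real_Asymp.Real_Asymp"
begin

text \<open>
  Put \<open>N = 2\<^sup>n\<close> and \<open>x = \<alpha>\<pi>\<close>. Since \<open>2 sin z cos z = sin 2z\<close>, a block of \<open>n\<close> factors, starting at an
  index divisible by \<open>n\<close>, equals \<open>F(x) / N\<close> with \<open>F(x) = \<bar>sin (Nx) / cos x\<bar>\<close>, and the next block is evaluated
  at \<open>Nx\<close>. At \<open>x = \<pi>/2 - \<theta>\<close> with \<open>\<theta> = \<pi>/(2(N+1))\<close> we have \<open>Nx \<equiv> -x\<close> modulo \<open>\<pi>\<close>, so every block there
  contributes \<open>cot \<theta> / N\<close>, which is the second claim.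

  For the upper bound let \<open>d(x)\<close> be the distance of \<open>x\<close> from \<open>\<pi>/2 + \<pi>\<int>\<close>. It is enough to find \<open>s \<ge> 0\<close>
  with \<open>F(x) exp(-s d(Nx)) \<le> cot \<theta> exp(-s d(x))\<close>: the weights telescope along the orbit and lie between
  \<open>exp(-s\<pi>/2)\<close> and \<open>1\<close>. Equality holds at \<open>d(x) = \<theta>\<close>, and criticality of that point forces
  \<open>(N+1) s = cot \<theta> - N tan \<theta>\<close>. Write \<open>y = d(x)\<close>. On \<open>y \<le> \<pi>/(2N)\<close>, where \<open>d(Nx) = \<pi>/2 - Ny\<close>, the logarithm of the
  inequality is concave in \<open>y\<close>, so the critical point is the maximum. On \<open>y \<ge> \<pi>/(2N)\<close> the crude bound
  \<open>F(x) \<le> 1 / sin y\<close> suffices: \<open>s y - ln (sin y)\<close> is convex, so only the endpoints matter, and at \<open>y = \<pi>/2\<close>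
  the claim is \<open>exp(s\<pi>/2) \<le> cot \<theta>\<close>.
\<close>

definition fix_angle :: "nat \<Rightarrow> real" where
  "fix_angle N = pi / (2 * (real N + 1))"

definition fix_slope :: "nat \<Rightarrow> real" where
  "fix_slope N = (cot (fix_angle N) - real N * tan (fix_angle N)) / (real N + 1)"

text \<open>This is the d(x) of the overview; the arcsin form avoids an explicit reduction modulo
  pi.\<close>

definition line_dist :: "real \<Rightarrow> real" where
  "line_dist x = arcsin \<bar>cos x\<bar>"

text \<open>Supplies the convexity of \<open>u\<close> in \<open>tangent_bound\<close>.\<close>

lemma abs_sin_of_nat_mult_le: "\<bar>sin (real k * y)\<bar> \<le> real k * \<bar>sin y\<bar>"
proof (induction k)
  case (Suc k)
  have "\<bar>sin (real (Suc k) * y)\<bar> = \<bar>sin (real k * y) * cos y + cos (real k * y) * sin y\<bar>"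
    by (simp add: algebra_simps sin_add)
  also have "\<dots> \<le> \<bar>sin (real k * y)\<bar> * \<bar>cos y\<bar> + \<bar>cos (real k * y)\<bar> * \<bar>sin y\<bar>"
    by (metis abs_mult abs_triangle_ineq)
  also have "\<dots> \<le> \<bar>sin (real k * y)\<bar> * 1 + 1 * \<bar>sin y\<bar>"
    by (intro add_mono mult_mono) auto
  finally show ?case using Suc by (simp add: algebra_simps)
qed simp

section \<open>The one-block inequality for a multiplier N >= 2\<close>

context
  fixes N :: nat
  assumes N: "N \<ge> 2"
begin

lemma fix_angle_pos: "0 < fix_angle N"
  by (simp add: fix_angle_def)

lemma Suc_mult_fix_angle: "(real N + 1) * fix_angle N = pi / 2"
proof -
  have "k \<noteq> 0 \<Longrightarrow> k * (pi / (2 * k)) = pi / 2" for k :: real by simp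
  then show ?thesis unfolding fix_angle_def by (metis of_nat_Suc of_nat_eq_0_iff nat.distinct(1) add.commute)
qed

lemma fix_angle_mult: "real N * fix_angle N = pi / 2 - fix_angle N"
  using Suc_mult_fix_angle by (simp add: algebra_simps)

lemma fix_angle_le: "fix_angle N \<le> pi / 6"
  unfolding fix_angle_def using N by (intro divide_left_mono) auto

lemma fix_angle_less: "fix_angle N < pi / real N"
  unfolding fix_angle_def using N by (intro divide_strict_left_mono) (auto intro: mult_pos_pos)

lemma sin_fix_angle_pos: "0 < sin (fix_angle N)"
  using fix_angle_pos fix_angle_le pi_gt_zero by (intro sin_gt_zero) linarith+

lemma cos_fix_angle_pos: "0 < cos (fix_angle N)"
  using fix_angle_pos fix_angle_le pi_gt_zero by (intro cos_gt_zero) linarith+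

lemma tan_fix_angle_pos: "0 < tan (fix_angle N)"
  using sin_fix_angle_pos cos_fix_angle_pos by (simp add: tan_def)

lemma cot_fix_angle: "cot (fix_angle N) = 1 / tan (fix_angle N)"
  by (simp add: tan_def cot_def)

lemma tan_fix_angle_less_1: "tan (fix_angle N) < 1"
proof -
  have "tan (fix_angle N) < tan (pi / 4)"
    using fix_angle_pos fix_angle_le pi_gt_zero by (intro tan_monotone) linarith+
  then show ?thesis by (simp add: tan_45)
qed

lemma cot_fix_angle_ge_1: "1 \<le> cot (fix_angle N)"
  using tan_fix_angle_less_1 tan_fix_angle_pos by (simp add: cot_fix_angle)

lemma fix_slope_mult: "(real N + 1) * fix_slope N = cot (fix_angle N) - real N * tan (fix_angle N)"
  unfolding fix_slope_def by simp

lemma fix_slope_pi_half: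
  "fix_slope N * (pi / 2) = fix_angle N * cot (fix_angle N) - real N * fix_angle N * tan (fix_angle N)"
proof -
  have "fix_slope N * (pi / 2) = fix_angle N * ((real N + 1) * fix_slope N)"
    by (simp flip: Suc_mult_fix_angle)
  then show ?thesis unfolding fix_slope_mult by (simp add: algebra_simps)
qed

text \<open>With t = tan \<theta>: \<theta> \<le> t gives \<theta> cot \<theta> \<le> 1, and N
  \<theta> = pi/2 - \<theta> \<ge> pi/3 > 1. The exponent is thus at most 1 - t, hence at most -ln
  t.\<close>

lemma exp_fix_slope_le: "exp (fix_slope N * (pi / 2)) \<le> cot (fix_angle N)"
proof -
  let ?t = "tan (fix_angle N)"
  have "arctan ?t = fix_angle N"
    using fix_angle_pos fix_angle_le pi_gt_zero by (intro arctan_tan) linarith+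
  then have "fix_angle N \<le> ?t"
    using arctan_le_self[of ?t] tan_fix_angle_pos by simp
  then have "fix_angle N * cot (fix_angle N) \<le> 1"
    using tan_fix_angle_pos by (simp add: cot_fix_angle)
  moreover have "1 * ?t \<le> real N * fix_angle N * ?t"
    using fix_angle_mult fix_angle_le pi_gt3 tan_fix_angle_pos
    by (intro mult_right_mono) linarith+
  ultimately have "fix_slope N * (pi / 2) \<le> 1 - ?t"
    unfolding fix_slope_pi_half by simp
  also have "\<dots> \<le> - ln ?t"
    using ln_le_minus_one[OF tan_fix_angle_pos] by simp
  finally have "exp (fix_slope N * (pi / 2)) \<le> exp (- ln ?t)" by simp
  also have "\<dots> = cot (fix_angle N)"
    using tan_fix_angle_pos by (simp add: exp_minus cot_fix_angle field_simps)
  finally show ?thesis .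
qed

text \<open>Clearing denominators leaves (N+1) sin^2 \<theta> \<le> 1. By sin \<theta> \<le>
  \<theta> and (N+1) \<theta> = pi/2 the left side is at most pi^2/12 < 1.\<close>

lemma fix_slope_nonneg: "0 \<le> fix_slope N"
proof -
  let ?\<theta> = "fix_angle N"
  have "(real N + 1) * (sin ?\<theta>)\<^sup>2 \<le> (real N + 1) * ?\<theta>\<^sup>2"
    using sin_fix_angle_pos fix_angle_pos
    by (intro mult_left_mono power_mono sin_x_le_x) auto
  also have "\<dots> = pi / 2 * ?\<theta>"
    by (simp add: power2_eq_square flip: Suc_mult_fix_angle)
  also have "\<dots> \<le> (3.2 / 2) * (3.2 / 6)"
    using fix_angle_pos fix_angle_le pi_approx by (intro mult_mono) auto
  also have "\<dots> \<le> 1" by simp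
  finally have "real N * (sin ?\<theta>)\<^sup>2 \<le> (cos ?\<theta>)\<^sup>2"
    by (simp add: cos_squared_eq algebra_simps)
  then show ?thesis
    using sin_fix_angle_pos cos_fix_angle_pos
    by (auto simp: fix_slope_def tan_def cot_def field_simps power2_eq_square)
qed

text \<open>Up to constants, \<open>u\<close> is the logarithm of right side over left side; it is
  convex with a horizontal tangent at \<theta>, where equality holds. Only positivity of sin (N y)
  is needed, so the range extends past pi/(2N), and \<open>tail_bound\<close> can evaluate at that
  point.\<close>

lemma tangent_bound:
  assumes y: "0 < y" "y < pi / real N"
  shows "sin (real N * y) * exp (fix_slope N * ((real N + 1) * y - pi / 2))
           \<le> cot (fix_angle N) * sin y"
proof -
  let ?\<theta> = "fix_angle N" and ?s = "fix_slope N"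
  define u where "u = (\<lambda>y. ln (sin y) - ln (sin (real N * y)) - ?s * (real N + 1) * y)"
  define u' where "u' = (\<lambda>y. cot y - real N * cot (real N * y) - ?s * (real N + 1))"
  define u'' where "u'' = (\<lambda>y. - inverse ((sin y)\<^sup>2) + (real N)\<^sup>2 * inverse ((sin (real N * y))\<^sup>2))"
  let ?I = "{0<..<pi / real N}"
  have pos: "0 < sin z" "0 < sin (real N * z)" if "z \<in> ?I" for z
  proof -
    have "pi / real N \<le> pi" using N by (simp add: field_simps)
    then show "0 < sin z" using that by (intro sin_gt_zero) auto
    show "0 < sin (real N * z)" using that N by (intro sin_gt_zero) (auto simp: field_simps)
  qed
  have du: "(u has_real_derivative u' z) (at z)" if "z \<in> ?I" for z
    unfolding u_def u'_def using pos[OF that]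
    by (auto intro!: derivative_eq_intros simp: cot_def field_simps)
  have du': "(u' has_real_derivative u'' z) (at z)" if "z \<in> ?I" for z
    unfolding u''_def u'_def using pos[OF that]
    by (auto intro!: derivative_eq_intros DERIV_cot DERIV_chain2[OF DERIV_cot]
        simp: power2_eq_square)
  have nonneg: "u'' z \<ge> 0" if "z \<in> ?I" for z
  proof -
    have "sin (real N * z) \<le> real N * sin z"
      using abs_sin_of_nat_mult_le[of N z] pos[OF that] by simp
    then have "(sin (real N * z))\<^sup>2 \<le> (real N * sin z)\<^sup>2"
      using pos[OF that] by (intro power_mono) auto
    then show ?thesis using pos[OF that]
      by (simp add: u''_def field_simps)
  qed
  have conv: "convex_on ?I u"
    by (rule f''_ge0_imp_convex[where f' = u' and f'' = u'']) (use du du' nonneg in auto)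
  have \<theta>: "?\<theta> \<in> ?I" using fix_angle_pos fix_angle_less by auto
  \<comment> \<open>The slope was chosen for this: cot (N \<theta>) = tan \<theta>, because N
    \<theta> = pi/2 - \<theta>.\<close>
  have "u' ?\<theta> = 0"
    unfolding u'_def fix_angle_mult
    using fix_slope_mult by (simp add: cot_def tan_def sin_diff cos_diff algebra_simps)
  then have "(u has_real_derivative 0) (at ?\<theta> within ?I)"
    using du[OF \<theta>] by (auto intro: has_field_derivative_at_within)
  then have "u y - u ?\<theta> \<ge> 0 * (y - ?\<theta>)"
    using conv \<theta> y by (intro convex_on_imp_above_tangent[of ?I]) (auto simp: interior_open)
  moreover have "u ?\<theta> = ln (sin ?\<theta>) - ln (cos ?\<theta>) - ?s * (pi / 2)"
    unfolding u_def fix_angle_mult mult.assoc Suc_mult_fix_angle by (simp add: sin_diff)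
  ultimately have "ln (sin (real N * y)) + ?s * ((real N + 1) * y - pi / 2)
      \<le> ln (cos ?\<theta>) - ln (sin ?\<theta>) + ln (sin y)"
    unfolding u_def by (simp add: algebra_simps)
  then have "exp (ln (sin (real N * y)) + ?s * ((real N + 1) * y - pi / 2))
      \<le> exp (ln (cos ?\<theta>) - ln (sin ?\<theta>) + ln (sin y))" by simp
  then show ?thesis
    using pos[of y] y sin_fix_angle_pos cos_fix_angle_pos
    by (simp add: exp_add exp_diff cot_def)
qed

text \<open>The case y = 0, where sin (N y) / sin y has its limit N: let y tend to 0 from the right
  in \<open>tangent_bound\<close>.\<close>

lemma peak_bound: "real N * exp (- (fix_slope N * (pi / 2))) \<le> cot (fix_angle N)"
proof -
  let ?s = "fix_slope N"
  have N0: "real N > 0" using N by simp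
  have "((\<lambda>y. sin (real N * y) / sin y * exp (?s * ((real N + 1) * y - pi / 2)))
      \<longlongrightarrow> real N * exp (- (?s * (pi / 2)))) (at_right 0)"
  proof (rule tendsto_mult)
    show "((\<lambda>y. sin (real N * y) / sin y) \<longlongrightarrow> real N) (at_right 0)"
      using N0 by real_asymp
    have "((\<lambda>y. exp (?s * ((real N + 1) * y - pi / 2)))
        \<longlongrightarrow> exp (?s * ((real N + 1) * 0 - pi / 2))) (at_right 0)"
      by (intro tendsto_intros)
    then show "((\<lambda>y. exp (?s * ((real N + 1) * y - pi / 2)))
        \<longlongrightarrow> exp (- (?s * (pi / 2)))) (at_right 0)" by simp
  qed
  moreover have "eventually (\<lambda>y. y \<in> {0<..<pi / real N}) (at_right 0)"
    using N0 by (intro eventually_at_right_real) auto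
  then have "eventually (\<lambda>y. sin (real N * y) / sin y
      * exp (?s * ((real N + 1) * y - pi / 2)) \<le> cot (fix_angle N)) (at_right 0)"
  proof eventually_elim
    case (elim y)
    have "pi / real N \<le> pi" using N by (simp add: field_simps)
    then have "0 < sin y" using elim by (intro sin_gt_zero) auto
    then show ?case using tangent_bound[of y] elim by (simp add: field_simps)
  qed
  ultimately show ?thesis by (rule tendsto_upperbound) simp
qed

lemma tail_bound:
  assumes y: "pi / (2 * real N) \<le> y" "y \<le> pi / 2"
  shows "exp (fix_slope N * y) \<le> cot (fix_angle N) * sin y"
proof -
  let ?s = "fix_slope N" and ?M = "cot (fix_angle N)" and ?y = "pi / (2 * real N)"
  have N0: "real N > 0" using N by simp
  have M: "?M > 0" using cot_fix_angle_ge_1 by simp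
  define g where "g = (\<lambda>y. ?s * y - ln (sin y))"
  have y0: "0 < ?y" "?y \<le> pi / 2" using N by (auto simp: field_simps)
  have pos: "0 < sin z" if "z \<in> {0<..<pi}" for z using that by (intro sin_gt_zero) auto
  have conv: "convex_on {0<..<pi} g"
  proof (rule f''_ge0_imp_convex)
    show "(g has_real_derivative ?s - cot z) (at z)" if "z \<in> {0<..<pi}" for z
      unfolding g_def using pos[OF that]
      by (auto intro!: derivative_eq_intros simp: cot_def)
    show "((\<lambda>z. ?s - cot z) has_real_derivative inverse ((sin z)\<^sup>2)) (at z)"
      if "z \<in> {0<..<pi}" for z
      using pos[OF that] by (auto intro!: derivative_eq_intros DERIV_cot)
  qed auto
  have "exp (?s * ?y) \<le> ?M * sin ?y"
  proof -
    \<comment> \<open>At the left endpoint sin (N y) = 1 and (N+1) y - pi/2 = y, so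
      \<open>tangent_bound\<close> becomes the required inequality.\<close>
    have 1: "real N * ?y = pi / 2" using N0 by simp
    have "(real N + 1) * ?y - pi / 2 = ?y" unfolding distrib_right 1 by simp
    then show ?thesis using tangent_bound[of ?y] y0 N0 unfolding 1 by (simp add: field_simps)
  qed
  then have "ln (exp (?s * ?y)) \<le> ln (?M * sin ?y)"
    using M pos[of ?y] y0 by (subst ln_le_cancel_iff) auto
  then have end1: "g ?y \<le> ln ?M"
    using M pos[of ?y] y0 pi_gt_zero unfolding g_def by (subst (asm) ln_mult) auto
  have "ln (exp (?s * (pi / 2))) \<le> ln ?M"
    using exp_fix_slope_le M by (subst ln_le_cancel_iff) auto
  then have end2: "g (pi / 2) \<le> ln ?M" unfolding g_def by simp
  have "convex_on {?y..pi / 2} g"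
    by (rule convex_on_subset[OF conv]) (use y0 in auto)
  then have "g y \<le> max (g ?y) (g (pi / 2))"
    using y by (intro convex_on_le_max) auto
  then have "g y \<le> ln ?M" using end1 end2 by simp
  then have "?s * y \<le> ln ?M + ln (sin y)" unfolding g_def by simp
  then have "exp (?s * y) \<le> exp (ln ?M + ln (sin y))" by simp
  then show ?thesis using M pos[of y] y y0 by (simp add: exp_add)
qed

text \<open>\<open>F\<close> stands for \<bar>sin (N y) / sin y\<bar>. The product form covers y = 0
  as well, where it leaves \<open>F\<close> undetermined and the bound by N takes over, with
  \<open>peak_bound\<close>.\<close>

lemma step_bound:
  assumes y: "0 \<le> y" "y \<le> pi / 2"
    and F: "0 \<le> F" "F \<le> real N" "F * sin y = \<bar>sin (real N * y)\<bar>"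
  shows "F * exp (- (fix_slope N * arcsin \<bar>cos (real N * y)\<bar>))
           \<le> cot (fix_angle N) * exp (- (fix_slope N * y))"
proof -
  let ?s = "fix_slope N" and ?M = "cot (fix_angle N)" and ?d = "arcsin \<bar>cos (real N * y)\<bar>"
  have N0: "real N > 0" using N by simp
  consider "y = 0" | "0 < y" "y \<le> pi / (2 * real N)" | "pi / (2 * real N) \<le> y"
    using y by linarith
  then show ?thesis
  proof cases
    case 1
    have "F * exp (- (?s * (pi / 2))) \<le> real N * exp (- (?s * (pi / 2)))"
      using F by (intro mult_right_mono) auto
    also note peak_bound
    finally show ?thesis using 1 by simp
  next
    case 2
    have Ny: "0 \<le> real N * y" "real N * y \<le> pi / 2"
      using 2 N0 by (auto simp: field_simps)
    have siny: "0 < sin y" using 2 y by (intro sin_gt_zero) auto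
    have "arcsin (sin (pi / 2 - real N * y)) = pi / 2 - real N * y"
      using Ny by (intro arcsin_sin) auto
    moreover have "0 \<le> cos (real N * y)" "0 \<le> sin (real N * y)"
      using Ny by (auto intro!: cos_ge_zero sin_ge_zero)
    ultimately have d: "?d = pi / 2 - real N * y" and Fs: "F * sin y = sin (real N * y)"
      using F by (auto simp: sin_diff)
    have e: "exp (- (?s * ?d)) = exp (?s * ((real N + 1) * y - pi / 2)) * exp (- (?s * y))"
      unfolding d exp_add[symmetric] by (simp add: algebra_simps)
    have "real N * y < pi" using Ny pi_gt_zero by linarith
    then have "y < pi / real N" using N0 by (simp add: field_simps)
    then have "F * sin y * exp (?s * ((real N + 1) * y - pi / 2)) \<le> ?M * sin y"
      unfolding Fs using 2 by (intro tangent_bound)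
    then have "(F * exp (?s * ((real N + 1) * y - pi / 2))) * sin y \<le> ?M * sin y"
      by (simp add: mult_ac)
    then have "F * exp (?s * ((real N + 1) * y - pi / 2)) \<le> ?M"
      using siny by simp
    then show ?thesis unfolding e by (simp flip: mult.assoc)
  next
    case 3
    \<comment> \<open>Away from the peak the weight on the left is simply dropped, and F sin y \<le>
      1 suffices.\<close>
    have "0 \<le> ?d" by (intro arcsin_nonneg) auto
    then have "F * exp (- (?s * ?d)) \<le> F * 1"
      using F fix_slope_nonneg by (intro mult_left_mono) auto
    also have "\<dots> = F * exp (?s * y) * exp (- (?s * y))"
      by (simp flip: exp_add)
    also have "\<dots> \<le> F * (?M * sin y) * exp (- (?s * y))"
      using 3 y F by (intro mult_right_mono mult_left_mono tail_bound) auto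
    also have "\<dots> = \<bar>sin (real N * y)\<bar> * (?M * exp (- (?s * y)))"
      using F by (simp add: mult_ac flip: F(3))
    also have "\<dots> \<le> 1 * (?M * exp (- (?s * y)))"
      using cot_fix_angle_ge_1 by (intro mult_right_mono) auto
    finally show ?thesis by simp
  qed
qed

end

section \<open>Replacing x by its distance from the zeros of cos\<close>

lemma line_dist_bounds: "0 \<le> line_dist x" "line_dist x \<le> pi / 2"
  unfolding line_dist_def
  by (intro arcsin_nonneg arcsin_ubound; simp add: order_trans[of _ 0])+

lemma sin_line_dist: "sin (line_dist x) = \<bar>cos x\<bar>"
  unfolding line_dist_def by (intro sin_arcsin) (auto intro: order_trans[of _ 0])

lemma abs_cos_line_dist: "\<bar>cos (line_dist x)\<bar> = \<bar>sin x\<bar>"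
proof -
  have "(cos (line_dist x))\<^sup>2 = (sin x)\<^sup>2"
    unfolding cos_squared_eq sin_line_dist by (simp add: sin_squared_eq)
  then show ?thesis by (simp add: power2_eq_iff abs_eq_iff)
qed

text \<open>The first doubling gives cos (2 d(x)) = -cos (2x), and later ones depend only on the
  squared cosine. Exponent 0 is excluded: there sine and cosine are swapped.\<close>

lemma abs_cos_power2_mult_line_dist:
  assumes "m \<ge> 1"
  shows "\<bar>cos (2 ^ m * line_dist x)\<bar> = \<bar>cos (2 ^ m * x)\<bar>"
  using assms
proof (induction m rule: dec_induct)
  case base
  show ?case
    unfolding power_one_right cos_double using abs_cos_line_dist[of x]
    by (metis abs_minus_commute power2_abs sin_line_dist)
next
  case (step m)
  then have "(cos (2 ^ m * line_dist x))\<^sup>2 = (cos (2 ^ m * x))\<^sup>2"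
    by (metis power2_abs)
  then show ?case
    using cos_double_cos[of "2 ^ m * line_dist x"] cos_double_cos[of "2 ^ m * x"]
    by (simp add: mult.assoc)
qed

lemma abs_sin_power2_mult_line_dist:
  assumes "m \<ge> 1"
  shows "\<bar>sin (2 ^ m * line_dist x)\<bar> = \<bar>sin (2 ^ m * x)\<bar>"
proof -
  have "(sin (2 ^ m * line_dist x))\<^sup>2 = (sin (2 ^ m * x))\<^sup>2"
    unfolding sin_squared_eq using abs_cos_power2_mult_line_dist[OF assms, of x]
    by (metis power2_abs)
  then show ?thesis by (simp add: power2_eq_iff abs_eq_iff)
qed

section \<open>Splitting the product into blocks\<close>

lemma cos_prod_nonneg: "0 \<le> cos_prod r \<gamma> \<alpha>"
  unfolding cos_prod_def by (intro prod_nonneg) auto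

lemma cos_prod_le_1: "cos_prod r \<gamma> \<alpha> \<le> 1"
  unfolding cos_prod_def by (intro prod_le_1) auto

lemma cos_prod_add:
  "cos_prod (a + b) \<gamma> \<alpha> = cos_prod a \<gamma> \<alpha> * cos_prod b (shift_seq a \<gamma>) (2 ^ a * \<alpha>)"
  unfolding cos_prod_def shift_seq_def
  by (subst lessThan_atLeast0, subst prod.atLeastLessThan_concat[symmetric, of 0 a])
     (auto simp: prod.atLeastLessThan_shift_0[of _ a] lessThan_atLeast0 power_add mult_ac)

lemma shift_seq_shift_seq: "shift_seq a (shift_seq b \<gamma>) = shift_seq (b + a) \<gamma>"
  by (simp add: shift_seq_def fun_eq_iff add.assoc)

lemma shift_seq_c_seq: "n dvd l \<Longrightarrow> shift_seq l (c_seq n) = c_seq n"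
  by (simp add: shift_seq_def c_seq_def fun_eq_iff dvd_add_right_iff)

text \<open>The shift at index 0 turns the first cosine into a sine; the extra factor \<bar>cos
  x\<bar> then starts the double-angle telescoping. It runs up to k = n because indices strictly
  between 0 and n carry no shift.\<close>

lemma cos_prod_c_seq_block:
  assumes "1 \<le> k" "k \<le> n"
  shows "2 ^ k * cos_prod k (c_seq n) \<alpha> * \<bar>cos (\<alpha> * pi)\<bar> = \<bar>sin (2 ^ k * (\<alpha> * pi))\<bar>"
  using assms
proof (induction k rule: dec_induct)
  case base
  have "\<bar>sin (2 * (\<alpha> * pi))\<bar> = 2 * \<bar>sin (\<alpha> * pi)\<bar> * \<bar>cos (\<alpha> * pi)\<bar>"
    by (simp add: sin_double abs_mult)
  then show ?case by (simp add: cos_prod_def c_seq_def cos_add)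
next
  case (step k)
  then have "c_seq n k = 0" by (auto simp: c_seq_def dest: dvd_imp_le)
  then have "2 ^ Suc k * cos_prod (Suc k) (c_seq n) \<alpha> * \<bar>cos (\<alpha> * pi)\<bar>
      = 2 * \<bar>sin (2 ^ k * (\<alpha> * pi))\<bar> * \<bar>cos (2 ^ k * (\<alpha> * pi))\<bar>"
    using step by (simp add: cos_prod_def mult_ac)
  also have "\<dots> = \<bar>sin (2 * (2 ^ k * (\<alpha> * pi)))\<bar>"
    by (simp add: sin_double abs_mult)
  finally show ?case by (simp add: mult_ac)
qed

section \<open>Iteration over blocks: upper bound and extremal orbit\<close>

lemma cos_prod_c_seq_Suc:
  "cos_prod (n * Suc L) (c_seq n) \<alpha>
     = cos_prod n (c_seq n) \<alpha> * cos_prod (n * L) (c_seq n) (2 ^ n * \<alpha>)"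
  using cos_prod_add[of n "n * L" "c_seq n" \<alpha>] by (simp add: shift_seq_c_seq)

text \<open>The weight at the current point stays in the bound so that \<open>step_bound\<close> can
  be iterated; the factor exp (s pi/2) pays for it at L = 0, where d \<le> pi/2.\<close>

lemma cos_prod_c_seq_le:
  fixes n :: nat and \<alpha> :: real
  assumes n: "n \<ge> 1"
  defines "s \<equiv> fix_slope (2 ^ n)" and "M \<equiv> cot (fix_angle (2 ^ n))"
  shows "2 ^ (n * L) * cos_prod (n * L) (c_seq n) \<alpha>
           \<le> M ^ L * (exp (s * (pi / 2)) * exp (- (s * line_dist (\<alpha> * pi))))"
proof (induction L arbitrary: \<alpha>)
  have N: "(2::nat) \<le> 2 ^ n" using power_increasing[OF n, of "2::nat"] by simp
  {
    case 0
    have "s * line_dist (\<alpha> * pi) \<le> s * (pi / 2)"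
      unfolding s_def using fix_slope_nonneg[OF N] line_dist_bounds by (intro mult_left_mono)
    then show ?case by (simp add: cos_prod_def flip: exp_add)
  next
    case (Suc L)
    let ?F = "2 ^ n * cos_prod n (c_seq n) \<alpha>"
    let ?E = "exp (- (s * line_dist (2 ^ n * \<alpha> * pi)))"
    have F0: "0 \<le> ?F" using cos_prod_nonneg by simp
    have M1: "1 \<le> M" unfolding M_def by (rule cot_fix_angle_ge_1[OF N])
    have "?F * exp (- (s * arcsin \<bar>cos (real (2 ^ n) * line_dist (\<alpha> * pi))\<bar>))
        \<le> M * exp (- (s * line_dist (\<alpha> * pi)))"
      unfolding s_def M_def
    proof (rule step_bound[OF N])
      show "?F \<le> real (2 ^ n)" using cos_prod_le_1 by simp
      show "?F * sin (line_dist (\<alpha> * pi)) = \<bar>sin (real (2 ^ n) * line_dist (\<alpha> * pi))\<bar>"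
        using cos_prod_c_seq_block[OF n order_refl]
        by (simp add: sin_line_dist abs_sin_power2_mult_line_dist[OF n])
    qed (use F0 line_dist_bounds in auto)
    \<comment> \<open>Since \<bar>cos (2^n d(x))\<bar> = \<bar>cos (2^n x)\<bar>, the arcsin is the
      distance of the next orbit point.\<close>
    then have *: "?F * ?E \<le> M * exp (- (s * line_dist (\<alpha> * pi)))"
      by (simp add: abs_cos_power2_mult_line_dist[OF n] line_dist_def[of "2 ^ n * (\<alpha> * pi)"] mult.assoc)
    have "2 ^ (n * Suc L) * cos_prod (n * Suc L) (c_seq n) \<alpha>
        = ?F * (2 ^ (n * L) * cos_prod (n * L) (c_seq n) (2 ^ n * \<alpha>))"
      unfolding cos_prod_c_seq_Suc by (simp add: power_add)
    also have "\<dots> \<le> ?F * (M ^ L * (exp (s * (pi / 2)) * ?E))"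
      by (intro mult_left_mono Suc F0)
    also have "\<dots> = M ^ L * exp (s * (pi / 2)) * (?F * ?E)" by simp
    also have "\<dots> \<le> M ^ L * exp (s * (pi / 2)) * (M * exp (- (s * line_dist (\<alpha> * pi))))"
      using M1 by (intro mult_left_mono[OF *]) auto
    finally show ?case by (simp add: mult_ac)
  }
qed

text \<open>Factors before the first multiple of n and in the last incomplete block are bounded by
  1. Fewer than 2n are lost, which costs at most 2^(2n) = 4^n.\<close>

lemma cos_prod_shift_c_seq_le:
  fixes n r l :: nat and \<alpha> :: real
  assumes n: "n \<ge> 1"
  shows "cos_prod r (shift_seq l (c_seq n)) \<alpha>
    \<le> 4 ^ n * exp (fix_slope (2 ^ n) * (pi / 2)) * (1 / 2 ^ r)
        * cot (fix_angle (2 ^ n)) powr (real r / real n)"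
proof -
  have N: "(2::nat) \<le> 2 ^ n" using power_increasing[OF n, of "2::nat"] by simp
  define s where "s = fix_slope (2 ^ n)"
  define M where "M = cot (fix_angle (2 ^ n))"
  have s: "0 \<le> s" unfolding s_def by (rule fix_slope_nonneg[OF N])
  have M1: "1 \<le> M" unfolding M_def by (rule cot_fix_angle_ge_1[OF N])
  \<comment> \<open>The least offset with n dividing l + p; the outer \<open>mod\<close> gives 0
    when n divides l. If r < p, truncated subtraction makes \<open>L\<close> zero.\<close>
  define p where "p = (n - l mod n) mod n"
  define L where "L = (r - p) div n"
  have "p < n" using n by (simp add: p_def)
  have dvd: "n dvd l + p"
  proof -
    have "(l + (n - l mod n)) mod n = 0"
    proof -
      have "l mod n < n" using n by simp
      then have "l + (n - l mod n) = n * (l div n) + n"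
        using mult_div_mod_eq[of n l] by linarith
      then show ?thesis by simp
    qed
    then show ?thesis by (simp add: p_def mod_add_right_eq dvd_eq_mod_eq_0)
  qed
  have "n * L \<le> r - p" by (simp add: L_def)
  have "r - p < n * L + n"
    using n by (metis L_def add.commute dividend_less_div_times less_eq_Suc_le mult.commute One_nat_def)
  then have r: "r \<le> n * L + 2 * n" using \<open>p < n\<close> by linarith
  have "cos_prod r (shift_seq l (c_seq n)) \<alpha> \<le> cos_prod (n * L) (c_seq n) (2 ^ p * \<alpha>)"
  proof (cases "p \<le> r")
    case True
    then have "r = p + n * L + (r - p - n * L)" using \<open>n * L \<le> r - p\<close> by linarith
    then have "cos_prod r (shift_seq l (c_seq n)) \<alpha>
        = cos_prod (p + n * L + (r - p - n * L)) (shift_seq l (c_seq n)) \<alpha>" by simp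
    also have "\<dots> \<le> cos_prod (p + n * L) (shift_seq l (c_seq n)) \<alpha>"
      unfolding cos_prod_add[of "p + n * L"] 
      by (intro mult_right_le_one_le cos_prod_nonneg cos_prod_le_1)
    also have "\<dots> \<le> cos_prod (n * L) (c_seq n) (2 ^ p * \<alpha>)"
      unfolding cos_prod_add shift_seq_shift_seq shift_seq_c_seq[OF dvd]
      by (intro mult_left_le_one_le cos_prod_nonneg cos_prod_le_1)
    finally show ?thesis .
  next
    case False
    then have "L = 0" by (simp add: L_def)
    then show ?thesis using cos_prod_le_1 by (simp add: cos_prod_def[of 0])
  qed
  also have "\<dots> \<le> 1 / 2 ^ (n * L) * (M ^ L * exp (s * (pi / 2)))"
  proof -
    have "2 ^ (n * L) * cos_prod (n * L) (c_seq n) (2 ^ p * \<alpha>)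
        \<le> M ^ L * (exp (s * (pi / 2)) * exp (- (s * line_dist (2 ^ p * \<alpha> * pi))))"
      unfolding s_def M_def by (rule cos_prod_c_seq_le[OF n])
    also have "\<dots> \<le> M ^ L * (exp (s * (pi / 2)) * 1)"
      using s M1 line_dist_bounds by (intro mult_left_mono) auto
    finally show ?thesis by (simp add: field_simps)
  qed
  also have "\<dots> \<le> 4 ^ n * (1 / 2 ^ r) * (M powr (real r / real n) * exp (s * (pi / 2)))"
  proof (intro mult_mono)
    have "(2::real) ^ r \<le> 2 ^ (n * L + 2 * n)" using r by (intro power_increasing) auto
    also have "\<dots> = 2 ^ (n * L) * 4 ^ n" by (simp add: power_add power_mult)
    finally show "1 / 2 ^ (n * L) \<le> 4 ^ n * (1 / (2::real) ^ r)"
      by (simp add: field_simps)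
    \<comment> \<open>As M \<ge> 1, the number of full blocks may be raised to r/n in the
      exponent.\<close>
    have "real L \<le> real r / real n"
      using n \<open>n * L \<le> r - p\<close>
      by (simp add: field_simps flip: of_nat_mult)
    then have "M powr real L \<le> M powr (real r / real n)"
      using M1 by (intro powr_mono) auto
    then show "M ^ L \<le> M powr (real r / real n)"
      using M1 by (simp add: powr_realpow)
  qed (use M1 in auto)
  finally show ?thesis unfolding s_def M_def by (simp add: mult_ac)
qed

text \<open>The hypothesis says d(x) = \<theta>, and N \<theta> = pi/2 - \<theta> passes it on to N
  x. Hence every block contributes the same factor.\<close>

lemma cos_prod_c_seq_fixed:
  fixes n :: nat
  assumes n: "n \<ge> 1" and \<alpha>: "\<bar>cos (\<alpha> * pi)\<bar> = sin (fix_angle (2 ^ n))"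
  shows "2 ^ (n * L) * cos_prod (n * L) (c_seq n) \<alpha> = cot (fix_angle (2 ^ n)) ^ L"
  using \<alpha>
proof (induction L arbitrary: \<alpha>)
  have N: "(2::nat) \<le> 2 ^ n" using power_increasing[OF n, of "2::nat"] by simp
  {
    case 0
    then show ?case by (simp add: cos_prod_def)
  next
    case (Suc L)
    let ?\<theta> = "fix_angle (2 ^ n)" and ?x = "\<alpha> * pi"
    have d: "line_dist ?x = ?\<theta>"
      unfolding line_dist_def Suc.prems
      using fix_angle_pos[OF N] fix_angle_le[OF N] pi_gt_zero by (intro arcsin_sin) linarith+
    have \<theta>: "2 ^ n * ?\<theta> = pi / 2 - ?\<theta>" using fix_angle_mult[OF N] by simp
    have "\<bar>cos (2 ^ n * ?x)\<bar> = \<bar>sin ?\<theta>\<bar>"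
      unfolding abs_cos_power2_mult_line_dist[OF n, symmetric] d \<theta> by (simp add: cos_diff)
    then have cos: "\<bar>cos (2 ^ n * \<alpha> * pi)\<bar> = sin ?\<theta>"
      using sin_fix_angle_pos[OF N] by (simp add: mult.assoc)
    have "\<bar>sin (2 ^ n * ?x)\<bar> = \<bar>cos ?\<theta>\<bar>"
      unfolding abs_sin_power2_mult_line_dist[OF n, symmetric] d \<theta> by (simp add: sin_diff)
    then have "2 ^ n * cos_prod n (c_seq n) \<alpha> * sin ?\<theta> = cos ?\<theta>"
      using cos_prod_c_seq_block[OF n order_refl, of \<alpha>] Suc.prems cos_fix_angle_pos[OF N] by simp
    then have F: "2 ^ n * cos_prod n (c_seq n) \<alpha> = cot ?\<theta>"
      using sin_fix_angle_pos[OF N] by (simp add: cot_def field_simps)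
    have "2 ^ (n * Suc L) * cos_prod (n * Suc L) (c_seq n) \<alpha>
        = (2 ^ n * cos_prod n (c_seq n) \<alpha>) * (2 ^ (n * L) * cos_prod (n * L) (c_seq n) (2 ^ n * \<alpha>))"
      unfolding cos_prod_c_seq_Suc by (simp add: power_add)
    then show ?case unfolding F Suc.IH[OF cos] by simp
  }
qed

theorem theorem3p1:
  fixes n :: nat
  assumes "n \<ge> 1"
  shows "(\<exists>C::real. C > 0 \<and>
            (\<forall>\<alpha>\<in>{0..1::real}. \<forall>r::nat. \<forall>l::nat. r \<ge> 1 \<longrightarrow>
               cos_prod r (shift_seq l (c_seq n)) \<alpha>
                 \<le> C * 2 powi (- int r) * cot (pi / (2 * (2 ^ n + 1))) powr (real r / real n)))
       \<and> (\<forall>L::nat. L \<ge> 1 \<longrightarrow>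
            cos_prod (n * L) (c_seq n) (2 ^ (n - 1) / (2 ^ n + 1))
              = 2 powi (- int (n * L)) * cot (pi / (2 * (2 ^ n + 1))) ^ L)"
proof -
  have \<theta>: "pi / (2 * (2 ^ n + 1)) = fix_angle (2 ^ n)" by (simp add: fix_angle_def)
  have powi: "2 powi (- int k) = 1 / (2::real) ^ k" for k
    by (simp add: power_int_minus divide_inverse)
  have N: "(2::nat) \<le> 2 ^ n" using power_increasing[OF assms, of "2::nat"] by simp
  define \<alpha> :: real where "\<alpha> = 2 ^ (n - 1) / (2 ^ n + 1)"
  \<comment> \<open>Halving 2^n shows that the given \<alpha> satisfies \<alpha> pi = N \<theta> =
    pi/2 - \<theta>, the extremal point.\<close>
  have "(2::real) ^ n = 2 * 2 ^ (n - 1)" using assms by (simp flip: power_Suc)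
  moreover have "a / k * pi = 2 * a * (pi / (2 * k))" for a k :: real by simp
  ultimately have "\<alpha> * pi = 2 ^ n * fix_angle (2 ^ n)"
    by (simp only: \<alpha>_def fix_angle_def of_nat_power of_nat_numeral)
  then have "\<alpha> * pi = pi / 2 - fix_angle (2 ^ n)"
    using fix_angle_mult[OF N] by simp
  then have "\<bar>cos (\<alpha> * pi)\<bar> = sin (fix_angle (2 ^ n))"
    using sin_fix_angle_pos[OF N] by (simp add: cos_diff)
  from cos_prod_c_seq_fixed[OF assms this]
  have "cos_prod (n * L) (c_seq n) \<alpha> = 1 / 2 ^ (n * L) * cot (fix_angle (2 ^ n)) ^ L" for L
    by (simp add: field_simps)
  moreover have "0 < 4 ^ n * exp (fix_slope (2 ^ n) * (pi / 2))" by simp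
  ultimately show ?thesis
    unfolding \<theta> powi \<alpha>_def using cos_prod_shift_c_seq_le[OF assms] by blast
qed

end
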